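(* Let $\mathbb G$ be a quantum permutation group with commutative $C^*$-algebra $C(\mathbb G)$. Then the free wreath product $\mathbb G\wr_*\mathbb Z_2$ has no nonlocal symmetry.
   Context: A magic unitary is a matrix $U=(u_{ij})\in M_n(\mathcal A)$ over a unital $C^*$-algebra $\mathcal A$ with $u_{ij}=u_{ij}^*=u_{ij}^2$ and $\sum_ku_{ik}=\sum_ku_{ki}=\mathbf 1$ for all $i,j$. A compact matrix quantum group is a pair $\mathbb G=(C(\mathbb G),U)$ with $C(\mathbb G)$ a unital $C^*$-algebra generated by the entries of $U=(u_{ij})\in M_n(C(\mathbb G))$ (the fundamental representation), such that there is a $*$-homomorphism $C(\mathbb G)\to C(\mathbb G)\otimes C(\mathbb G)$ (minimal tensor product) with $u_{ij}\mapsto\sum_ku_{ik}\otimes u_{kj}$, and $U$, $U^T$ are invertible. A quantum permutation group is a quantum subgroup of the quantum symmetric group $S_n^+$, i.e. a compact matrix quantum group whose fundamental representation $U$ is a magic unitary. A quantum permutation group $\mathbb G$ with fundamental representation $U\in M_n(C(\mathbb G))$ exhibits (has) nonlocal symmetry if there is a tracial state $\tau$ on $C(\mathbb G)$ such that the correlation $p(l,k|i,j)=\tau(u_{il}u_{jk})$ is nonlocal (non-classical), i.e. not a convex combination of the correlations $p_\pi$, $\pi\in S_n$, where $p_\pi(l,k|i,j)=1$ if $l=\pi(i)$ and $k=\pi(j)$, and $0$ otherwise. For $\mathbb G=(C(\mathbb G),U)$, $U\in M_n(C(\mathbb G))$, and $\mathbb H=(C(\mathbb H),V)$, $V\in M_m(C(\mathbb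 H))$, the free wreath product is $\mathbb G\wr_*\mathbb H=(C(\mathbb G)*_wC(\mathbb H),W)$ with $W=(w_{ia,jb})=(u^{(a)}_{ij}v_{ab})$, where $U^{(a)}=(u_{ij}^{(a)})$, $1\le a\le m$, are copies of $U$ and $C(\mathbb G)*_wC(\mathbb H)$ is the universal $C^*$-algebra generated by the $u^{(a)}_{ij},v_{ab}$ with the relations of $C(\mathbb G)^{*m}*C(\mathbb H)$ (unital free product) and additionally $u_{ij}^{(a)}v_{ab}=v_{ab}u_{ij}^{(a)}$. Here $\mathbb Z_2$ is the permutation group acting on two points, viewed as a quantum permutation group with fundamental representation of the form $\begin{pmatrix}q&1-q\\1-q&q\end{pmatrix}$, $q$ a projection. *)

theory Defs
  imports "HOL-Analysis.Analysis" "HOL-Algebra.Algebra"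
begin

section \<open>Unital C*-algebras\<close>

record 'a cstar = "(complex, 'a) module" +
  adj :: "'a \<Rightarrow> 'a"
  nrm :: "'a \<Rightarrow> real"

definition complex_ring :: "complex ring" where
  "complex_ring = \<lparr>carrier = UNIV, monoid.mult = (*), one = 1, ring.zero = 0, add = (+)\<rparr>"

locale cstar_algebra =
  fixes A :: "'a cstar" (structure)
  assumes ring: "ring A"
    and module: "module complex_ring A"
    and smult_mult_left:
      "\<lbrakk>x \<in> carrier A; y \<in> carrier A\<rbrakk> \<Longrightarrow> (c \<odot> x) \<otimes> y = c \<odot> (x \<otimes> y)"
    and smult_mult_right:
      "\<lbrakk>x \<in> carrier A; y \<in> carrier A\<rbrakk> \<Longrightarrow> x \<otimes> (c \<odot> y) = c \<odot> (x \<otimes> y)"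
    and adj_closed: "x \<in> carrier A \<Longrightarrow> adj A x \<in> carrier A"
    and adj_adj: "x \<in> carrier A \<Longrightarrow> adj A (adj A x) = x"
    and adj_add: "\<lbrakk>x \<in> carrier A; y \<in> carrier A\<rbrakk> \<Longrightarrow> adj A (x \<oplus> y) = adj A x \<oplus> adj A y"
    and adj_smult: "x \<in> carrier A \<Longrightarrow> adj A (c \<odot> x) = cnj c \<odot> adj A x"
    and adj_mult: "\<lbrakk>x \<in> carrier A; y \<in> carrier A\<rbrakk> \<Longrightarrow> adj A (x \<otimes> y) = adj A y \<otimes> adj A x"
    and nrm_nonneg: "x \<in> carrier A \<Longrightarrow> 0 \<le> nrm A x"
    and nrm_eq_0: "x \<in> carrier A \<Longrightarrow> nrm A x = 0 \<longleftrightarrow> x = \<zero>"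
    and nrm_triangle: "\<lbrakk>x \<in> carrier A; y \<in> carrier A\<rbrakk> \<Longrightarrow> nrm A (x \<oplus> y) \<le> nrm A x + nrm A y"
    and nrm_smult: "x \<in> carrier A \<Longrightarrow> nrm A (c \<odot> x) = cmod c * nrm A x"
    and nrm_mult: "\<lbrakk>x \<in> carrier A; y \<in> carrier A\<rbrakk> \<Longrightarrow> nrm A (x \<otimes> y) \<le> nrm A x * nrm A y"
    and cstar_identity: "x \<in> carrier A \<Longrightarrow> nrm A (adj A x \<otimes> x) = (nrm A x)\<^sup>2"
    and complete:
      "\<lbrakk>\<And>n. Y n \<in> carrier A; \<And>e. e > 0 \<Longrightarrow> \<exists>N. \<forall>m\<ge>N. \<forall>n\<ge>N. nrm A (Y m \<ominus> Y n) < e\<rbrakk>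
        \<Longrightarrow> \<exists>L\<in>carrier A. (\<lambda>n. nrm A (Y n \<ominus> L)) \<longlonglongrightarrow> 0"

definition cstar_subalgebra :: "'a set \<Rightarrow> 'a cstar \<Rightarrow> bool" where
  "cstar_subalgebra T A \<longleftrightarrow>
     subring T A \<and> (\<forall>c. \<forall>x\<in>T. c \<odot>\<^bsub>A\<^esub> x \<in> T) \<and> (\<forall>x\<in>T. adj A x \<in> T) \<and>
     (\<forall>Y L. (\<forall>n. Y n \<in> T) \<and> L \<in> carrier A \<and> (\<lambda>n. nrm A (Y n \<ominus>\<^bsub>A\<^esub> L)) \<longlonglongrightarrow> 0 \<longrightarrow> L \<in> T)"

definition cstar_generated :: "'a cstar \<Rightarrow> 'a set \<Rightarrow> 'a set" where
  "cstar_generated A S = \<Inter> {T. cstar_subalgebra T A \<and> S \<subseteq> T}"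

text \<open>Unital *-homomorphisms: HOL-Algebra's ring homomorphisms preserve the unit.\<close>

definition star_hom :: "'a cstar \<Rightarrow> 'b cstar \<Rightarrow> ('a \<Rightarrow> 'b) set" where
  "star_hom A B = {h \<in> ring_hom A B.
     \<forall>x\<in>carrier A. (\<forall>c. h (c \<odot>\<^bsub>A\<^esub> x) = c \<odot>\<^bsub>B\<^esub> h x) \<and> h (adj A x) = adj B (h x)}"

section \<open>Bounded operators and the minimal tensor product\<close>

definition ell2 :: "('x \<Rightarrow> complex) set" where
  "ell2 = {f. (\<lambda>x. (cmod (f x))\<^sup>2) summable_on UNIV}"

definition ell2_inner :: "('x \<Rightarrow> complex) \<Rightarrow> ('x \<Rightarrow> complex) \<Rightarrow> complex" where
  "ell2_inner f g = (\<Sum>\<^sub>\<infinity>x. cnj (f x) * g x)"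

definition ell2_norm :: "('x \<Rightarrow> complex) \<Rightarrow> real" where
  "ell2_norm f = sqrt (\<Sum>\<^sub>\<infinity>x. (cmod (f x))\<^sup>2)"

text \<open>An operator on the Hilbert space \<open>ell2\<close> is represented by a total function that
  vanishes outside \<open>ell2\<close>, so that equality of operators is equality of functions.\<close>

definition bounded_ops :: "(('x \<Rightarrow> complex) \<Rightarrow> ('x \<Rightarrow> complex)) set" where
  "bounded_ops = {T.
     (\<forall>f. f \<notin> ell2 \<longrightarrow> T f = (\<lambda>x. 0)) \<and>
     (\<forall>f\<in>ell2. T f \<in> ell2) \<and>
     (\<forall>f\<in>ell2. \<forall>g\<in>ell2. T (\<lambda>x. f x + g x) = (\<lambda>x. T f x + T g x)) \<and>
     (\<forall>c. \<forall>f\<in>ell2. T (\<lambda>x. c * f x) = (\<lambda>x. c * T f x)) \<and>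
     (\<exists>K. \<forall>f\<in>ell2. ell2_norm (T f) \<le> K * ell2_norm f)}"

definition bounded_ops_cstar :: "(('x \<Rightarrow> complex) \<Rightarrow> ('x \<Rightarrow> complex)) cstar" where
  "bounded_ops_cstar = \<lparr>
     carrier = bounded_ops,
     monoid.mult = (\<lambda>S T. S \<circ> T),
     one = (\<lambda>f. if f \<in> ell2 then f else (\<lambda>x. 0)),
     ring.zero = (\<lambda>f x. 0),
     add = (\<lambda>S T f x. S f x + T f x),
     smult = (\<lambda>c T f x. c * T f x),
     adj = (\<lambda>T. THE S. S \<in> bounded_ops \<and>
              (\<forall>f\<in>ell2. \<forall>g\<in>ell2. ell2_inner (T f) g = ell2_inner f (S g))),
     nrm = (\<lambda>T. SUP f\<in>{f \<in> ell2. ell2_norm f \<le> 1}. ell2_norm (T f)) \<rparr>"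

text \<open>The operator \<open>S \<otimes> T\<close> on the Hilbert space tensor product, realised as \<open>ell2\<close> over the
  product of the index types: apply \<open>T\<close> in the second variable, then \<open>S\<close> in the first.\<close>

definition op_tensor :: "(('x \<Rightarrow> complex) \<Rightarrow> ('x \<Rightarrow> complex)) \<Rightarrow> (('y \<Rightarrow> complex) \<Rightarrow> ('y \<Rightarrow> complex))
    \<Rightarrow> (('x \<times> 'y \<Rightarrow> complex) \<Rightarrow> ('x \<times> 'y \<Rightarrow> complex))" where
  "op_tensor S T = (\<lambda>f. if f \<in> ell2
     then (\<lambda>(x, y). S (\<lambda>x'. T (\<lambda>y'. f (x', y')) y) x) else (\<lambda>z. 0))"

text \<open>Every non-zero C*-algebra carried by a subset of \<open>'a\<close> has a faithful representation on
  the Hilbert space of dimension \<open>'a\<close>: take GNS spaces of one norming state per element, each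
  of dimension at most the cardinality of the algebra, and then a suitable multiple.\<close>

definition faithful_rep :: "'a cstar \<Rightarrow> ('a \<Rightarrow> ('a \<Rightarrow> complex) \<Rightarrow> ('a \<Rightarrow> complex)) \<Rightarrow> bool" where
  "faithful_rep A \<rho> \<longleftrightarrow> \<rho> \<in> star_hom A bounded_ops_cstar \<and> inj_on \<rho> (carrier A)"

text \<open>The minimal (spatial) tensor product, which up to isomorphism does not depend on the
  faithful representations \<open>\<rho>\<close> and \<open>\<sigma>\<close>. The C*-algebra generated by the elementary tensors
  is the closure of their linear span, since this span is a unital *-algebra.\<close>

definition min_tensor :: "'a cstar \<Rightarrow> ('a \<Rightarrow> ('a \<Rightarrow> complex) \<Rightarrow> ('a \<Rightarrow> complex)) \<Rightarrow>
    'b cstar \<Rightarrow> ('b \<Rightarrow> ('b \<Rightarrow> complex) \<Rightarrow> ('b \<Rightarrow> complex)) \<Rightarrow>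
    (('a \<times> 'b \<Rightarrow> complex) \<Rightarrow> ('a \<times> 'b \<Rightarrow> complex)) cstar" where
  "min_tensor A \<rho> B \<sigma> = bounded_ops_cstar
     \<lparr>carrier := cstar_generated bounded_ops_cstar
        {op_tensor (\<rho> a) (\<sigma> b) | a b. a \<in> carrier A \<and> b \<in> carrier B}\<rparr>"

section \<open>Quantum permutation groups\<close>

text \<open>Matrices are indexed by an arbitrary finite set \<open>I\<close>, because the fundamental
  representation of a wreath product is indexed by pairs.\<close>

definition magic_unitary :: "'i set \<Rightarrow> 'a cstar \<Rightarrow> ('i \<Rightarrow> 'i \<Rightarrow> 'a) \<Rightarrow> bool" where
  "magic_unitary I A U \<longleftrightarrow>
     (\<forall>i\<in>I. \<forall>j\<in>I. U i j \<in> carrier A \<and> adj A (U i j) = U i j \<and> U i j \<otimes>\<^bsub>A\<^esub> U i j = U i j) \<and>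
     (\<forall>i\<in>I. (\<Oplus>\<^bsub>A\<^esub>k\<in>I. U i k) = \<one>\<^bsub>A\<^esub> \<and> (\<Oplus>\<^bsub>A\<^esub>k\<in>I. U k i) = \<one>\<^bsub>A\<^esub>)"

definition invertible_matrix :: "'i set \<Rightarrow> 'a cstar \<Rightarrow> ('i \<Rightarrow> 'i \<Rightarrow> 'a) \<Rightarrow> bool" where
  "invertible_matrix I A U \<longleftrightarrow>
     (\<exists>Y. (\<forall>i\<in>I. \<forall>j\<in>I. Y i j \<in> carrier A) \<and>
       (\<forall>i\<in>I. \<forall>j\<in>I.
          (\<Oplus>\<^bsub>A\<^esub>k\<in>I. U i k \<otimes>\<^bsub>A\<^esub> Y k j) = (if i = j then \<one>\<^bsub>A\<^esub> else \<zero>\<^bsub>A\<^esub>) \<and>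
          (\<Oplus>\<^bsub>A\<^esub>k\<in>I. Y i k \<otimes>\<^bsub>A\<^esub> U k j) = (if i = j then \<one>\<^bsub>A\<^esub> else \<zero>\<^bsub>A\<^esub>)))"

definition has_comultiplication :: "'i set \<Rightarrow> 'a cstar \<Rightarrow> ('i \<Rightarrow> 'i \<Rightarrow> 'a) \<Rightarrow> bool" where
  "has_comultiplication I A U \<longleftrightarrow>
     (\<exists>\<rho>. faithful_rep A \<rho> \<and>
       (\<exists>\<Delta> \<in> star_hom A (min_tensor A \<rho> A \<rho>). \<forall>i\<in>I. \<forall>j\<in>I.
          \<Delta> (U i j) = (\<Oplus>\<^bsub>min_tensor A \<rho> A \<rho>\<^esub>k\<in>I. op_tensor (\<rho> (U i k)) (\<rho> (U k j)))))"

definition compact_matrix_quantum_group ::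
    "'i set \<Rightarrow> 'a cstar \<Rightarrow> ('i \<Rightarrow> 'i \<Rightarrow> 'a) \<Rightarrow> bool" where
  "compact_matrix_quantum_group I A U \<longleftrightarrow>
     finite I \<and> cstar_algebra A \<and> (\<forall>i\<in>I. \<forall>j\<in>I. U i j \<in> carrier A) \<and>
     cstar_generated A {U i j | i j. i \<in> I \<and> j \<in> I} = carrier A \<and>
     has_comultiplication I A U \<and>
     invertible_matrix I A U \<and> invertible_matrix I A (\<lambda>i j. U j i)"

definition quantum_permutation_group ::
    "'i set \<Rightarrow> 'a cstar \<Rightarrow> ('i \<Rightarrow> 'i \<Rightarrow> 'a) \<Rightarrow> bool" where
  "quantum_permutation_group I A U \<longleftrightarrow>
     compact_matrix_quantum_group I A U \<and> magic_unitary I A U"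

section \<open>Nonlocal symmetry\<close>

definition tracial_state :: "'a cstar \<Rightarrow> ('a \<Rightarrow> complex) \<Rightarrow> bool" where
  "tracial_state A \<tau> \<longleftrightarrow>
     (\<forall>x\<in>carrier A. \<forall>y\<in>carrier A. \<tau> (x \<oplus>\<^bsub>A\<^esub> y) = \<tau> x + \<tau> y) \<and>
     (\<forall>c. \<forall>x\<in>carrier A. \<tau> (c \<odot>\<^bsub>A\<^esub> x) = c * \<tau> x) \<and>
     (\<forall>x\<in>carrier A. \<tau> (adj A x \<otimes>\<^bsub>A\<^esub> x) \<in> \<real>\<^sub>\<ge>\<^sub>0) \<and>
     \<tau> \<one>\<^bsub>A\<^esub> = 1 \<and>
     (\<forall>x\<in>carrier A. \<forall>y\<in>carrier A. \<tau> (x \<otimes>\<^bsub>A\<^esub> y) = \<tau> (y \<otimes>\<^bsub>A\<^esub> x))"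

text \<open>The arguments of a correlation \<open>p(l,k|i,j)\<close> are taken in the order \<open>l k i j\<close>.\<close>

definition trace_correlation ::
    "'a cstar \<Rightarrow> ('i \<Rightarrow> 'i \<Rightarrow> 'a) \<Rightarrow> ('a \<Rightarrow> complex) \<Rightarrow> 'i \<Rightarrow> 'i \<Rightarrow> 'i \<Rightarrow> 'i \<Rightarrow> complex" where
  "trace_correlation A U \<tau> l k i j = \<tau> (U i l \<otimes>\<^bsub>A\<^esub> U j k)"

definition perm_correlation :: "('i \<Rightarrow> 'i) \<Rightarrow> 'i \<Rightarrow> 'i \<Rightarrow> 'i \<Rightarrow> 'i \<Rightarrow> real" where
  "perm_correlation \<pi> l k i j = (if l = \<pi> i \<and> k = \<pi> j then 1 else 0)"

definition local_correlation :: "'i set \<Rightarrow> ('i \<Rightarrow> 'i \<Rightarrow> 'i \<Rightarrow> 'i \<Rightarrow> complex) \<Rightarrow> bool" where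
  "local_correlation I p \<longleftrightarrow>
     (\<exists>c :: ('i \<Rightarrow> 'i) \<Rightarrow> real.
        (\<forall>\<pi>\<in>{\<pi>. \<pi> permutes I}. 0 \<le> c \<pi>) \<and> (\<Sum>\<pi> | \<pi> permutes I. c \<pi>) = 1 \<and>
        (\<forall>l\<in>I. \<forall>k\<in>I. \<forall>i\<in>I. \<forall>j\<in>I.
           p l k i j = of_real (\<Sum>\<pi> | \<pi> permutes I. c \<pi> * perm_correlation \<pi> l k i j)))"

definition nonlocal_symmetry :: "'i set \<Rightarrow> 'a cstar \<Rightarrow> ('i \<Rightarrow> 'i \<Rightarrow> 'a) \<Rightarrow> bool" where
  "nonlocal_symmetry I A U \<longleftrightarrow>
     (\<exists>\<tau>. tracial_state A \<tau> \<and> \<not> local_correlation I (trace_correlation A U \<tau>))"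

section \<open>Free wreath products\<close>

text \<open>The relations of the unital free product of the copies of \<open>A\<close> with \<open>B\<close> hold for elements
  of \<open>D\<close> iff these are the images of the generators under unital *-homomorphisms \<open>\<phi> a\<close>
  and \<open>\<psi>\<close>.\<close>

definition wreath_relations ::
    "'i set \<Rightarrow> 'a cstar \<Rightarrow> ('i \<Rightarrow> 'i \<Rightarrow> 'a) \<Rightarrow> 'j set \<Rightarrow> 'b cstar \<Rightarrow> ('j \<Rightarrow> 'j \<Rightarrow> 'b) \<Rightarrow>
     'd cstar \<Rightarrow> ('j \<Rightarrow> 'a \<Rightarrow> 'd) \<Rightarrow> ('b \<Rightarrow> 'd) \<Rightarrow> bool" where
  "wreath_relations I A U J B V D \<phi> \<psi> \<longleftrightarrow>
     (\<forall>a\<in>J. \<phi> a \<in> star_hom A D) \<and> \<psi> \<in> star_hom B D \<and>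
     (\<forall>i\<in>I. \<forall>j\<in>I. \<forall>a\<in>J. \<forall>b\<in>J.
        \<phi> a (U i j) \<otimes>\<^bsub>D\<^esub> \<psi> (V a b) = \<psi> (V a b) \<otimes>\<^bsub>D\<^esub> \<phi> a (U i j))"

text \<open>\<open>C\<close>, together with the canonical maps \<open>\<iota> a\<close> and \<open>\<kappa>\<close>, is the C*-algebra of the free wreath
  product of \<open>(A, U)\<close> by \<open>(B, V)\<close>; the universal property determines it up to isomorphism.

  Testing universality only against C*-algebras \<open>D\<close> with elements in the same type \<open>'c\<close> is no
  restriction. If \<open>C\<close> is non-zero, \<open>'c\<close> has at least the cardinality of the continuum. The images
  of the generators in an arbitrary \<open>D\<close> generate a separable C*-algebra, hence one of at most
  that cardinality, which has a copy with elements in \<open>'c\<close>.\<close>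

definition free_wreath_product ::
    "'i set \<Rightarrow> 'a cstar \<Rightarrow> ('i \<Rightarrow> 'i \<Rightarrow> 'a) \<Rightarrow> 'j set \<Rightarrow> 'b cstar \<Rightarrow> ('j \<Rightarrow> 'j \<Rightarrow> 'b) \<Rightarrow>
     'c cstar \<Rightarrow> ('j \<Rightarrow> 'a \<Rightarrow> 'c) \<Rightarrow> ('b \<Rightarrow> 'c) \<Rightarrow> bool" where
  "free_wreath_product I A U J B V C \<iota> \<kappa> \<longleftrightarrow>
     cstar_algebra C \<and> wreath_relations I A U J B V C \<iota> \<kappa> \<and>
     cstar_generated C ({\<iota> a (U i j) | a i j. a \<in> J \<and> i \<in> I \<and> j \<in> I} \<union>
                        {\<kappa> (V a b) | a b. a \<in> J \<and> b \<in> J}) = carrier C \<and>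
     (\<forall>(D :: 'c cstar) \<phi> \<psi>. cstar_algebra D \<and> wreath_relations I A U J B V D \<phi> \<psi> \<longrightarrow>
        (\<exists>\<theta> \<in> star_hom C D. (\<forall>a\<in>J. \<forall>x\<in>carrier A. \<theta> (\<iota> a x) = \<phi> a x) \<and>
           (\<forall>y\<in>carrier B. \<theta> (\<kappa> y) = \<psi> y)))"

definition wreath_matrix ::
    "('i \<Rightarrow> 'i \<Rightarrow> 'a) \<Rightarrow> ('j \<Rightarrow> 'j \<Rightarrow> 'b) \<Rightarrow> 'c cstar \<Rightarrow> ('j \<Rightarrow> 'a \<Rightarrow> 'c) \<Rightarrow> ('b \<Rightarrow> 'c) \<Rightarrow>
     'i \<times> 'j \<Rightarrow> 'i \<times> 'j \<Rightarrow> 'c" where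
  "wreath_matrix U V C \<iota> \<kappa> = (\<lambda>(i, a) (j, b). \<iota> a (U i j) \<otimes>\<^bsub>C\<^esub> \<kappa> (V a b))"

section \<open>Finite permutation groups as quantum permutation groups\<close>

definition fun_cstar :: "'g set \<Rightarrow> ('g \<Rightarrow> complex) cstar" where
  "fun_cstar G = \<lparr>
     carrier = extensional G,
     monoid.mult = (\<lambda>f h. \<lambda>g\<in>G. f g * h g),
     one = (\<lambda>g\<in>G. 1),
     ring.zero = (\<lambda>g\<in>G. 0),
     add = (\<lambda>f h. \<lambda>g\<in>G. f g + h g),
     smult = (\<lambda>c f. \<lambda>g\<in>G. c * f g),
     adj = (\<lambda>f. \<lambda>g\<in>G. cnj (f g)),
     nrm = (\<lambda>f. SUP g\<in>G. cmod (f g)) \<rparr>"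

definition perm_matrix :: "('j \<Rightarrow> 'j) set \<Rightarrow> 'j \<Rightarrow> 'j \<Rightarrow> ('j \<Rightarrow> 'j) \<Rightarrow> complex" where
  "perm_matrix G a b = (\<lambda>g\<in>G. if g b = a then 1 else 0)"

text \<open>The permutation group acting on the two points \<open>0\<close> and \<open>1\<close>.\<close>

definition Z2 :: "(nat \<Rightarrow> nat) set" where
  "Z2 = {g. g permutes {0, 1}}"

end

theory Submission
  imports Defs
begin

text \<open>Commuting projections \<open>u\<^sub>i\<^sub>j\<close> cut \<open>A\<close> into pieces on which each of them is \<open>0\<close> or \<open>1\<close>; the
  row and column sums kill all pieces except those given by permutation matrices. So the unit is
  a sum of projections \<open>p\<^sub>\<pi>\<close> with \<open>p\<^sub>\<pi> u\<^sub>i\<^sub>j = p\<^sub>\<pi>\<close> if \<open>\<pi> i = j\<close> and \<open>0\<close> otherwise. The spectral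
  projections \<open>e\<^sub>g\<close> of \<open>C(\<int>\<^sub>2)\<close> commute with both copies of the \<open>u\<^sub>i\<^sub>j\<close>, and \<open>(\<pi>, \<rho>, g)\<close> acts
  on \<open>I \<times> {0, 1}\<close> by \<open>(i, 0) \<mapsto> (\<pi> i, g 0)\<close> and \<open>(i, 1) \<mapsto> (\<rho> i, g 1)\<close>. Let \<open>q\<^sub>\<rho>\<close> be the
  second copy of \<open>p\<^sub>\<rho>\<close>. It need not commute with \<open>p\<^sub>\<pi>\<close>, but \<open>\<tau>\<close> is a trace, so the weights
  \<open>\<tau>(p\<^sub>\<pi> q\<^sub>\<rho> e\<^sub>g)\<close> are non-negative; and a product of two entries of the fundamental
  representation involves no more than one factor from each copy, after multiplication within
  the copies, so they reproduce all its traces.\<close>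

section \<open>Convex combinations of permutation correlations\<close>

text \<open>Adding the weights over each fibre of \<open>F\<close> gives the coefficient of a
  permutation. Fibres may have several elements: for empty \<open>I\<close>, both elements of
  \<open>Z2\<close> induce the identity on pairs.\<close>

lemma local_correlationI:
  fixes w :: "'t \<Rightarrow> real"
  assumes I: "finite I" and T: "finite T"
    and F: "\<And>t. t \<in> T \<Longrightarrow> F t permutes I"
    and w: "\<And>t. t \<in> T \<Longrightarrow> 0 \<le> w t" and w1: "sum w T = 1"
    and p: "\<And>l k i j. \<lbrakk>l \<in> I; k \<in> I; i \<in> I; j \<in> I\<rbrakk> \<Longrightarrow>
      p l k i j = of_real (\<Sum>t\<in>T. w t * perm_correlation (F t) l k i j)"
  shows "local_correlation I p"
proof -
  define c where "c \<sigma> = (\<Sum>t | t \<in> T \<and> F t = \<sigma>. w t)" for \<sigma>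
  have fin: "finite {\<sigma>. \<sigma> permutes I}"
    using I by (rule finite_permutations)
  have img: "F ` T \<subseteq> {\<sigma>. \<sigma> permutes I}"
    using F by blast
  have "(\<Sum>\<sigma> | \<sigma> permutes I. c \<sigma>) = 1"
    unfolding c_def using sum.group[OF T fin img, of w] w1 by simp
  moreover have "(\<Sum>\<sigma> | \<sigma> permutes I. c \<sigma> * perm_correlation \<sigma> l k i j)
      = (\<Sum>t\<in>T. w t * perm_correlation (F t) l k i j)" for l k i j
  proof -
    have "(\<Sum>\<sigma> | \<sigma> permutes I. c \<sigma> * perm_correlation \<sigma> l k i j)
      = (\<Sum>\<sigma> | \<sigma> permutes I. \<Sum>t | t \<in> T \<and> F t = \<sigma>. w t * perm_correlation (F t) l k i j)"
      unfolding c_def sum_distrib_right by (intro sum.cong) auto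
    then show ?thesis
      using sum.group[OF T fin img, of "\<lambda>t. w t * perm_correlation (F t) l k i j"] by simp
  qed
  moreover have "0 \<le> c \<sigma>" for \<sigma>
    unfolding c_def using w by (intro sum_nonneg) auto
  ultimately show ?thesis
    unfolding local_correlation_def using p by (intro exI[of _ c]) auto
qed

section \<open>Finite sums and commuting idempotents in rings\<close>

lemma (in ring) additive_finsum:
  fixes f :: "'a \<Rightarrow> 'z::comm_monoid_add"
  assumes "finite B" and "\<And>b. b \<in> B \<Longrightarrow> v b \<in> carrier R" and "f \<zero> = 0"
    and "\<And>x y. \<lbrakk>x \<in> carrier R; y \<in> carrier R\<rbrakk> \<Longrightarrow> f (x \<oplus> y) = f x + f y"
  shows "f (\<Oplus>b\<in>B. v b) = (\<Sum>b\<in>B. f (v b))"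
  using assms(1,2)
  by (induction B rule: finite_induct) (auto simp: assms(3,4) Pi_iff)

context cring
begin

text \<open>\<open>p S\<close> is the product of \<open>u x\<close> over \<open>x \<in> S\<close>
  and of \<open>\<one> \<ominus> u x\<close> over the other \<open>x \<in> K\<close>; a new
  idempotent splits each piece in two. As the pieces arise from the \<open>u x\<close> by ring
  operations, any property that defines a subring \<open>M\<close> passes to them.\<close>

lemma commuting_idempotents_decomposition:
  assumes M: "subring M R"
    and K: "finite K" and u: "\<And>x. x \<in> K \<Longrightarrow> u x \<in> M \<and> u x \<otimes> u x = u x"
  shows "\<exists>p. (\<forall>S\<in>Pow K. p S \<in> M \<and> p S \<otimes> p S = p S \<and>
      (\<forall>x\<in>K. p S \<otimes> u x = (if x \<in> S then p S else \<zero>))) \<and> (\<Oplus>S\<in>Pow K. p S) = \<one>"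
  using K u
proof (induction K rule: finite_induct)
  case empty
  then show ?case
    using subringE(3)[OF M] by (intro exI[of _ "\<lambda>_. \<one>"]) auto
next
  case (insert y K)
  then obtain p where p: "\<forall>S\<in>Pow K. p S \<in> M \<and> p S \<otimes> p S = p S \<and>
      (\<forall>x\<in>K. p S \<otimes> u x = (if x \<in> S then p S else \<zero>))"
    and p1: "(\<Oplus>S\<in>Pow K. p S) = \<one>"
    by blast
  have pM: "p S \<in> M" and pp: "p S \<otimes> p S = p S"
    and pu: "\<And>x. x \<in> K \<Longrightarrow> p S \<otimes> u x = (if x \<in> S then p S else \<zero>)" if "S \<subseteq> K" for S
    using p that by blast+
  have M_carrier: "x \<in> carrier R" if "x \<in> M" for x
    using that subringE(1)[OF M] by blast
  have pc: "p S \<in> carrier R" if "S \<subseteq> K" for S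
    using pM[OF that] by (rule M_carrier)
  have uc: "u x \<in> carrier R" if "x \<in> insert y K" for x
    using insert.prems[OF that] M_carrier by blast
  have uyu: "u y \<otimes> u y = u y"
    using insert.prems by blast
  define z where "z = \<one> \<ominus> u y"
  have zM: "z \<in> M"
    unfolding z_def a_minus_def using insert.prems subringE[OF M] by auto
  have zc: "z \<in> carrier R"
    using zM by (rule M_carrier)
  have uz: "u y \<oplus> z = \<one>"
    unfolding z_def using uc by (simp add: a_minus_def a_lcomm r_neg)
  have zu: "z \<otimes> u y = \<zero>"
    unfolding z_def a_minus_def using uc uyu by (simp add: l_distr l_minus r_neg)
  have zz: "z \<otimes> z = z"
  proof -
    have "z = z \<otimes> (u y \<oplus> z)" using uz zc by simp
    also have "\<dots> = z \<otimes> z" using zc uc zu by (simp add: r_distr)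
    finally show ?thesis by simp
  qed
  \<comment> \<open>The induction hypothesis controls \<open>p\<close> only on subsets of
    \<open>K\<close>, hence \<open>S - {y}\<close>; membership of \<open>y\<close> selects the half
    of that piece.\<close>
  define q where "q S = p (S - {y}) \<otimes> (if y \<in> S then u y else z)" for S
  have S: "S - {y} \<subseteq> K" if "S \<subseteq> insert y K" for S
    using that by blast
  have "q S \<in> M \<and> q S \<otimes> q S = q S \<and> (\<forall>x\<in>insert y K. q S \<otimes> u x = (if x \<in> S then q S else \<zero>))"
    if "S \<subseteq> insert y K" for S
  proof (intro conjI ballI)
    define r where "r = (if y \<in> S then u y else z)"
    have rM: "r \<in> M" and rr: "r \<otimes> r = r"
      and ru: "r \<otimes> u y = (if y \<in> S then r else \<zero>)"
      unfolding r_def using insert.prems zM zz zu by auto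
    have rc: "r \<in> carrier R" using rM by (rule M_carrier)
    note p' = pc[OF S[OF that]]
    have q: "q S = p (S - {y}) \<otimes> r"
      unfolding q_def r_def ..
    show "q S \<in> M"
      unfolding q using pM[OF S[OF that]] rM subringE(6)[OF M] by blast
    have "q S \<otimes> q S = (p (S - {y}) \<otimes> p (S - {y})) \<otimes> (r \<otimes> r)"
      unfolding q using p' rc by (simp add: m_ac)
    then show "q S \<otimes> q S = q S"
      unfolding q pp[OF S[OF that]] rr .
    fix x assume x: "x \<in> insert y K"
    show "q S \<otimes> u x = (if x \<in> S then q S else \<zero>)"
    proof (cases "x = y")
      case True
      then have "q S \<otimes> u x = p (S - {y}) \<otimes> (if y \<in> S then r else \<zero>)"
        unfolding q using p' rc uc[OF x] ru by (simp add: m_assoc)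
      then show ?thesis
        unfolding q using p' True by auto
    next
      case False
      have "q S \<otimes> u x = (p (S - {y}) \<otimes> u x) \<otimes> r"
        unfolding q using p' rc uc[OF x] by (simp add: m_ac)
      then show ?thesis
        using pu[OF S[OF that], of x] False x rc unfolding q by auto
    qed
  qed
  moreover have "(\<Oplus>S\<in>Pow (insert y K). q S) = \<one>"
  proof -
    have qc: "q S \<in> carrier R" if "S \<subseteq> insert y K" for S
      unfolding q_def using pc[OF S[OF that]] uc zc by simp
    have inj: "inj_on (insert y) (Pow K)"
      using insert.hyps(2) by (fastforce simp: inj_on_def insert_ident)
    \<comment> \<open>The subsets without \<open>y\<close> contribute \<open>z\<close>, those with
      \<open>y\<close> contribute \<open>u y\<close>.\<close>
    have "(\<Oplus>S\<in>Pow (insert y K). q S) = (\<Oplus>S\<in>Pow K. q S) \<oplus> (\<Oplus>S\<in>insert y ` Pow K. q S)"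
      unfolding Pow_insert
    proof (intro add.finprod_Un_disjoint)
      show "q \<in> insert y ` Pow K \<rightarrow> carrier R"
        using qc by blast
    qed (use insert.hyps qc in auto)
    also have "(\<Oplus>S\<in>insert y ` Pow K. q S) = (\<Oplus>S\<in>Pow K. q (insert y S))"
      using inj qc by (intro add.finprod_reindex) blast+
    also have "(\<Oplus>S\<in>Pow K. q S) = (\<Oplus>S\<in>Pow K. p S \<otimes> z)"
    proof (intro add.finprod_cong' refl)
      fix S assume "S \<in> Pow K"
      then have "y \<notin> S" using insert.hyps by blast
      then show "q S = p S \<otimes> z" by (simp add: q_def)
    qed (use pc zc in auto)
    also have "(\<Oplus>S\<in>Pow K. q (insert y S)) = (\<Oplus>S\<in>Pow K. p S \<otimes> u y)"
    proof (intro add.finprod_cong' refl)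
      fix S assume "S \<in> Pow K"
      then have "y \<notin> S" using insert.hyps by blast
      then show "q (insert y S) = p S \<otimes> u y" by (simp add: q_def)
    qed (use pc uc in auto)
    also have "(\<Oplus>S\<in>Pow K. p S \<otimes> z) \<oplus> (\<Oplus>S\<in>Pow K. p S \<otimes> u y) = \<one> \<otimes> z \<oplus> \<one> \<otimes> u y"
      using finsum_ldistr[of "Pow K" z p] finsum_ldistr[of "Pow K" "u y" p] pc zc uc
        insert.hyps(1) p1 by (simp add: Pi_def)
    also have "\<dots> = \<one>"
      using uz uc zc by (simp add: a_comm)
    finally show ?thesis .
  qed
  ultimately show ?case
    by (intro exI[of _ q]) auto
qed

text \<open>A piece is labelled by the positions \<open>S\<close> of the ones of a 0/1 matrix. Row
  and column sums equal to \<open>\<one>\<close> force one position per row and column if the piece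
  is non-zero; \<open>tf\<close> excludes that several ones add up to a single one, as could happen
  in positive characteristic.\<close>

lemma commutative_magic_decomposition:
  fixes I :: "'i set" and u :: "'i \<Rightarrow> 'i \<Rightarrow> 'a"
  assumes tf: "\<And>n x. \<lbrakk>x \<in> carrier R; add_pow R (n::nat) x = \<zero>\<rbrakk> \<Longrightarrow> n = 0 \<or> x = \<zero>"
    and M: "subring M R" and I: "finite I"
    and u: "\<And>i j. \<lbrakk>i \<in> I; j \<in> I\<rbrakk> \<Longrightarrow> u i j \<in> M \<and> u i j \<otimes> u i j = u i j"
    and row: "\<And>i. i \<in> I \<Longrightarrow> (\<Oplus>k\<in>I. u i k) = \<one>"
    and col: "\<And>i. i \<in> I \<Longrightarrow> (\<Oplus>k\<in>I. u k i) = \<one>"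
  obtains p where "\<And>\<pi>. \<pi> permutes I \<Longrightarrow> p \<pi> \<in> M \<and> p \<pi> \<otimes> p \<pi> = p \<pi>"
    and "\<And>\<pi> i j. \<lbrakk>\<pi> permutes I; i \<in> I; j \<in> I\<rbrakk> \<Longrightarrow> p \<pi> \<otimes> u i j = (if \<pi> i = j then p \<pi> else \<zero>)"
    and "(\<Oplus>\<pi>\<in>{\<pi>. \<pi> permutes I}. p \<pi>) = \<one>"
proof -
  define K where "K = I \<times> I"
  have K: "finite K" unfolding K_def using I by simp
  have "case_prod u x \<in> M \<and> case_prod u x \<otimes> case_prod u x = case_prod u x" if "x \<in> K" for x
    using that u unfolding K_def by auto
  then obtain P where P: "\<forall>S\<in>Pow K. P S \<in> M \<and> P S \<otimes> P S = P S \<and>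
      (\<forall>x\<in>K. P S \<otimes> case_prod u x = (if x \<in> S then P S else \<zero>))"
    and P1: "(\<Oplus>S\<in>Pow K. P S) = \<one>"
    using commuting_idempotents_decomposition[OF M K, of "case_prod u"] by blast
  have PM: "P S \<in> M" and PP: "P S \<otimes> P S = P S" if "S \<subseteq> K" for S
    using P that by blast+
  have Pu: "P S \<otimes> u i j = (if (i, j) \<in> S then P S else \<zero>)" if "S \<subseteq> K" "i \<in> I" "j \<in> I" for S i j
    using P that unfolding K_def by fastforce
  have Pc: "P S \<in> carrier R" if "S \<subseteq> K" for S
    using PM[OF that] subringE(1)[OF M] by blast
  have uc: "u i j \<in> carrier R" if "i \<in> I" "j \<in> I" for i j
    using u[OF that] subringE(1)[OF M] by blast
  \<comment> \<open>If \<open>n\<close> of the \<open>v k\<close> act on \<open>x\<close> as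
    \<open>1\<close> and the others as \<open>0\<close>, then \<open>x\<close> is \<open>n\<close>
    times \<open>x\<close>. As \<open>x\<close> is non-zero, so is \<open>n\<close>, and cancelling
    one \<open>x\<close> leaves \<open>n - 1\<close> times \<open>x\<close> equal to zero;
    \<open>tf\<close> gives \<open>n = 1\<close>.\<close>
  have count: "card {k \<in> I. k \<in> B} = 1"
    if x: "x \<in> carrier R" "x \<noteq> \<zero>"
      and v: "\<And>k. k \<in> I \<Longrightarrow> v k \<in> carrier R" "(\<Oplus>k\<in>I. v k) = \<one>"
      and xv: "\<And>k. k \<in> I \<Longrightarrow> x \<otimes> v k = (if k \<in> B then x else \<zero>)" for x v B
  proof -
    define n where "n = card {k \<in> I. k \<in> B}"
    have "x = (\<Oplus>k\<in>I. x \<otimes> v k)"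
      using finsum_rdistr[OF I x(1), of v] v x by (simp add: Pi_def)
    also have "\<dots> = (\<Oplus>k\<in>I. if k \<in> B then x else \<zero>)"
      using xv x by (intro add.finprod_cong') auto
    also have "\<dots> = (\<Oplus>k\<in>{k \<in> I. k \<in> B}. if k \<in> B then x else \<zero>)"
      using I x by (intro add.finprod_mono_neutral_cong_right) auto
    also have "\<dots> = (\<Oplus>k\<in>{k \<in> I. k \<in> B}. x)"
      using x by (intro add.finprod_cong') auto
    also have "\<dots> = add_pow R n x"
      unfolding n_def using x by (intro add.finprod_const) auto
    finally have nx: "x = add_pow R n x" .
    then have "n \<noteq> 0" using x by (intro notI) simp
    then obtain m where m: "n = Suc m" by (cases n) auto
    have "x = add_pow R m x \<oplus> x"
      using nx x unfolding m by (simp add: add.nat_pow_Suc)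
    then have "add_pow R m x = \<zero>"
      using x add.r_cancel_one' by (metis add.nat_pow_closed)
    then show ?thesis
      using tf[of x m] x m n_def by simp
  qed
  \<comment> \<open>The graph of \<open>\<pi>\<close> is the set of positions of the ones in its
    permutation matrix.\<close>
  define gr where "gr \<pi> = {(i, \<pi> i) |i. i \<in> I}" for \<pi> :: "'i \<Rightarrow> 'i"
  have gr_sub: "gr \<pi> \<subseteq> K" if "\<pi> permutes I" for \<pi>
    unfolding gr_def K_def using permutes_in_image[OF that] by auto
  have gr_inj: "inj_on gr {\<pi>. \<pi> permutes I}"
  proof (intro inj_onI ext)
    fix \<pi> \<rho> i assume *: "\<pi> \<in> {\<pi>. \<pi> permutes I}" "\<rho> \<in> {\<pi>. \<pi> permutes I}" "gr \<pi> = gr \<rho>"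
    show "\<pi> i = \<rho> i"
    proof (cases "i \<in> I")
      case True
      then have "(i, \<pi> i) \<in> gr \<rho>" using *(3) unfolding gr_def by blast
      then show ?thesis unfolding gr_def by auto
    qed (use * in \<open>simp add: permutes_not_in\<close>)
  qed
  have supp: "S \<in> gr ` {\<pi>. \<pi> permutes I}" if S: "S \<subseteq> K" and nz: "P S \<noteq> \<zero>" for S
  proof -
    have ex1: "\<exists>!k. k \<in> I \<and> k \<in> B" if "card {k \<in> I. k \<in> B} = 1" for B
    proof -
      obtain k where "{k \<in> I. k \<in> B} = {k}"
        using \<open>card {k \<in> I. k \<in> B} = 1\<close> by (rule card_1_singletonE)
      then show ?thesis by (intro ex1I[of _ k]) blast+
    qed
    have r: "\<exists>!k. k \<in> I \<and> (i, k) \<in> S" if "i \<in> I" for i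
      using ex1[OF count[OF Pc[OF S] nz, of "u i" "{k. (i, k) \<in> S}"]] uc[OF that]
        row[OF that] Pu[OF S that] by simp
    have c: "\<exists>!k. k \<in> I \<and> (k, i) \<in> S" if "i \<in> I" for i
      using ex1[OF count[OF Pc[OF S] nz, of "\<lambda>k. u k i" "{k. (k, i) \<in> S}"]] uc[OF _ that]
        col[OF that] Pu[OF S _ that] by simp
    \<comment> \<open>The column of the only one in row \<open>i\<close>; outside \<open>I\<close>
      the value must be \<open>i\<close> for \<open>\<pi> permutes I\<close>. Uniqueness in the
      columns will give injectivity.\<close>
    define \<pi> where "\<pi> i = (if i \<in> I then THE k. k \<in> I \<and> (i, k) \<in> S else i)" for i
    have \<pi>: "\<pi> i \<in> I \<and> (i, \<pi> i) \<in> S" if "i \<in> I" for i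
      unfolding \<pi>_def using theI'[OF r[OF that]] that by simp
    have "inj_on \<pi> I"
      using \<pi> c by (intro inj_onI) metis
    moreover have "\<pi> ` I \<subseteq> I" using \<pi> by blast
    ultimately have "bij_betw \<pi> I I"
      using I by (simp add: bij_betw_def endo_inj_surj)
    then have perm: "\<pi> permutes I"
      by (rule bij_imp_permutes) (simp add: \<pi>_def)
    have "S = gr \<pi>"
    proof (intro equalityI subsetI)
      fix x assume x: "x \<in> S"
      then obtain i k where ik: "x = (i, k)" "i \<in> I" "k \<in> I"
        using S unfolding K_def by blast
      then have "k = \<pi> i" using r \<pi> x by blast
      then show "x \<in> gr \<pi>" unfolding gr_def using ik by blast
    qed (use \<pi> in \<open>auto simp: gr_def\<close>)
    then show ?thesis using perm by blast
  qed
  \<comment> \<open>By \<open>supp\<close>, the pieces that are not labelled by graphs vanish, so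
    restricting to graphs keeps the sum.\<close>
  have "(\<Oplus>\<pi>\<in>{\<pi>. \<pi> permutes I}. P (gr \<pi>)) = (\<Oplus>S\<in>gr ` {\<pi>. \<pi> permutes I}. P S)"
    using Pc gr_sub gr_inj by (intro add.finprod_reindex[symmetric]) auto
  also have "\<dots> = (\<Oplus>S\<in>Pow K. P S)"
  proof (rule add.finprod_mono_neutral_cong_left)
    show "finite (Pow K)" using K by simp
    show "gr ` {\<pi>. \<pi> permutes I} \<subseteq> Pow K" using gr_sub by blast
    show "P S = \<zero>" if "S \<in> Pow K - gr ` {\<pi>. \<pi> permutes I}" for S
      using supp[of S] that by blast
  qed (use Pc in auto)
  finally have sum1: "(\<Oplus>\<pi>\<in>{\<pi>. \<pi> permutes I}. P (gr \<pi>)) = \<one>"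
    using P1 by simp
  show thesis
  proof (rule that[of "\<lambda>\<pi>. P (gr \<pi>)"])
    show "P (gr \<pi>) \<otimes> u i j = (if \<pi> i = j then P (gr \<pi>) else \<zero>)"
      if "\<pi> permutes I" "i \<in> I" "j \<in> I" for \<pi> i j
      using Pu[OF gr_sub[OF that(1)] that(2,3)] that(2) by (auto simp: gr_def)
  qed (use PM PP gr_sub sum1 in auto)
qed

end

section \<open>Integer multiples, adjoints and traces in C*-algebras\<close>

context cstar_algebra
begin

sublocale ring A by (rule ring)

lemma add_pow_eq_smult: "x \<in> carrier A \<Longrightarrow> add_pow A (n::nat) x = of_nat n \<odot> x"
proof (induction n)
  case 0
  have "(0::complex) \<odot> x \<oplus> 0 \<odot> x = (0 + 0) \<odot> x"
    using module.smult_l_distr[OF module, of 0 0 x] 0 by (simp add: complex_ring_def)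
  moreover have "(0::complex) \<odot> x \<in> carrier A"
    using module.smult_closed[OF module, of 0 x] 0 by (simp add: complex_ring_def)
  ultimately have "(0::complex) \<odot> x = \<zero>"
    by (simp add: add.r_cancel_one)
  then show ?case by simp
next
  case (Suc n)
  have "(of_nat n + 1 :: complex) \<odot> x = of_nat n \<odot> x \<oplus> 1 \<odot> x"
    using module.smult_l_distr[OF module, of "of_nat n" 1 x] Suc.prems
    by (simp add: complex_ring_def)
  moreover have "(1::complex) \<odot> x = x"
    using module.smult_one[OF module, of x] Suc.prems by (simp add: complex_ring_def)
  ultimately show ?case
    using Suc by (simp add: add.nat_pow_Suc add.commute)
qed

text \<open>The norm of \<open>n\<close> times \<open>x\<close> is \<open>n * nrm A x\<close>. This
  supplies the hypothesis \<open>tf\<close> of the decomposition.\<close>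

lemma torsion_free:
  assumes x: "x \<in> carrier A" and "add_pow A (n::nat) x = \<zero>"
  shows "n = 0 \<or> x = \<zero>"
  using nrm_smult[OF x, of "of_nat n"] nrm_eq_0[OF x] nrm_eq_0[OF zero_closed]
    assms by (simp add: add_pow_eq_smult)

lemma adj_one: "adj A \<one> = \<one>"
  using adj_mult[of "adj A \<one>" \<one>] adj_adj[of \<one>] adj_closed[of \<one>] by simp

lemma adj_uminus:
  assumes x: "x \<in> carrier A"
  shows "adj A (\<ominus> x) = \<ominus> adj A x"
proof -
  have "adj A \<zero> = \<zero>"
    using adj_add[of \<zero> \<zero>] adj_closed[of \<zero>] by (simp add: add.r_cancel_one)
  then have "adj A (\<ominus> x) \<oplus> adj A x = \<zero>"
    using adj_add[of "\<ominus> x" x] x by (simp add: l_neg)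
  then show ?thesis
    using x adj_closed by (simp add: minus_equality)
qed

text \<open>\<open>\<tau>(x y) = \<tau>((x y)\<^sup>* (x y))\<close>, since \<open>\<tau>\<close> is a trace.\<close>

lemma trace_projections_nonneg:
  assumes \<tau>: "tracial_state A \<tau>"
    and x: "x \<in> carrier A" "adj A x = x" "x \<otimes> x = x"
    and y: "y \<in> carrier A" "adj A y = y" "y \<otimes> y = y"
  shows "\<tau> (x \<otimes> y) \<in> \<real>\<^sub>\<ge>\<^sub>0"
proof -
  have "\<tau> (x \<otimes> y) = \<tau> (x \<otimes> y \<otimes> y)"
    using x y by (simp add: m_assoc)
  also have "\<dots> = \<tau> (y \<otimes> (x \<otimes> y))"
    using \<tau> x y unfolding tracial_state_def by simp
  also have "y \<otimes> (x \<otimes> y) = adj A (x \<otimes> y) \<otimes> (x \<otimes> y)"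
    using x y by (simp add: adj_mult m_assoc) (metis m_assoc)
  also have "\<tau> \<dots> \<in> \<real>\<^sub>\<ge>\<^sub>0"
    using \<tau> x y unfolding tracial_state_def by blast
  finally show ?thesis .
qed

end

section \<open>The group \<open>Z2\<close> and its function algebra\<close>

lemma Z2_eq: "Z2 = {id, Transposition.transpose 0 1}"
  unfolding Z2_def by (auto simp: permutes_doubleton_iff)

lemma finite_Z2: "finite Z2"
  by (simp add: Z2_eq)

lemma Z2_closed: "g \<in> Z2 \<Longrightarrow> a \<in> {0, 1} \<Longrightarrow> g a \<in> {0, 1}"
  unfolding Z2_def using permutes_in_image[of g "{0, 1}" a] by simp

lemma Z2_transitive:
  assumes "a \<in> {0, 1}" "b \<in> {0, 1}"
  obtains g where "g \<in> Z2" "g a = b"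
proof (cases "a = b")
  case True
  then show thesis using that[of id] by (simp add: Z2_eq)
next
  case False
  then show thesis
    using that[of "Transposition.transpose 0 1"] assms
    by (auto simp: Z2_eq Transposition.transpose_def)
qed

text \<open>The action on two points is free. The second equivalence holds because each element of
  \<open>Z2\<close> is its own inverse.\<close>

lemma Z2_regular:
  assumes "g \<in> Z2" "h \<in> Z2" "a \<in> {0, 1}"
  shows "g a = h a \<longleftrightarrow> g = h" and "h (g a) = a \<longleftrightarrow> h = g"
  using assms by (auto simp: Z2_eq fun_eq_iff Transposition.transpose_def)

text \<open>For \<open>g \<in> G\<close> these are the minimal projections of
  \<open>fun_cstar G\<close>.\<close>

definition fun_delta :: "'g set \<Rightarrow> 'g \<Rightarrow> 'g \<Rightarrow> complex" where
  "fun_delta G g = (\<lambda>h\<in>G. if h = g then 1 else 0)"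

text \<open>The entry is supported where \<open>h (g a) = a\<close>, that is on the inverse of
  \<open>g\<close>, which is \<open>g\<close>. So every entry of the fundamental representation of
  \<open>Z2\<close> is a minimal projection.\<close>

lemma perm_matrix_Z2: "g \<in> Z2 \<Longrightarrow> a \<in> {0, 1} \<Longrightarrow> perm_matrix Z2 a (g a) = fun_delta Z2 g"
  unfolding perm_matrix_def fun_delta_def using Z2_regular(2)[of g _ a] by (intro ext) auto

lemma fun_delta_facts:
  shows "fun_delta G g \<in> carrier (fun_cstar G)"
    and "adj (fun_cstar G) (fun_delta G g) = fun_delta G g"
    and "fun_delta G g \<otimes>\<^bsub>fun_cstar G\<^esub> fun_delta G h
      = (if g = h then fun_delta G g else \<zero>\<^bsub>fun_cstar G\<^esub>)"
  by (auto simp: fun_cstar_def fun_delta_def)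

lemma fun_cstar_zero: "\<zero>\<^bsub>fun_cstar G\<^esub> \<in> carrier (fun_cstar G)"
  "\<zero>\<^bsub>fun_cstar G\<^esub> \<oplus>\<^bsub>fun_cstar G\<^esub> \<zero>\<^bsub>fun_cstar G\<^esub> = \<zero>\<^bsub>fun_cstar G\<^esub>"
  by (auto simp: fun_cstar_def)

lemma fun_delta_Z2_sum:
  "fun_delta Z2 id \<oplus>\<^bsub>fun_cstar Z2\<^esub> fun_delta Z2 (Transposition.transpose 0 1) = \<one>\<^bsub>fun_cstar Z2\<^esub>"
proof -
  have "id \<noteq> Transposition.transpose 0 (1::nat)"
    by (auto simp: fun_eq_iff Transposition.transpose_def)
  then show ?thesis
    by (auto simp: fun_cstar_def fun_delta_def Z2_eq fun_eq_iff restrict_def)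
qed

section \<open>The classical wreath product acting on pairs\<close>

text \<open>The imprimitive action. The source block \<open>a\<close> selects the permutation, just
  as the row index selects the copy in \<open>wreath_matrix\<close>; the identity elsewhere is what
  \<open>permutes\<close> asks for.\<close>

definition wreath_perm ::
    "'i set \<Rightarrow> ('i \<Rightarrow> 'i) \<times> ('i \<Rightarrow> 'i) \<times> (nat \<Rightarrow> nat) \<Rightarrow> 'i \<times> nat \<Rightarrow> 'i \<times> nat" where
  "wreath_perm I = (\<lambda>(\<pi>, \<rho>, g) (i, a).
     if i \<in> I \<and> a \<in> {0, 1} then ((if a = 0 then \<pi> else \<rho>) i, g a) else (i, a))"

lemma wreath_perm_permutes:
  assumes I: "finite I" and perm: "\<pi> permutes I" "\<rho> permutes I" and g: "g \<in> Z2"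
  shows "wreath_perm I (\<pi>, \<rho>, g) permutes (I \<times> {0, 1})"
proof (rule bij_imp_permutes)
  let ?f = "wreath_perm I (\<pi>, \<rho>, g)"
  have "inj_on ?f (I \<times> {0, 1})"
  proof (rule inj_onI)
    fix x y assume x: "x \<in> I \<times> {0, 1}" and y: "y \<in> I \<times> {0, 1}" and eq: "?f x = ?f y"
    \<comment> \<open>The block is recovered first; then both points are moved by the same
      permutation of \<open>I\<close>.\<close>
    have "inj g" using g unfolding Z2_def by (auto dest: permutes_inj)
    then have "snd x = snd y"
      using x y eq by (auto simp: wreath_perm_def inj_eq)
    then show "x = y"
      using x y eq permutes_inj[OF perm(1)] permutes_inj[OF perm(2)]
      by (auto simp: wreath_perm_def inj_eq split: if_splits)
  qed
  moreover have "?f ` (I \<times> {0, 1}) \<subseteq> I \<times> {0, 1}"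
  proof (intro image_subsetI)
    fix x assume "x \<in> I \<times> {0::nat, 1}"
    then obtain i a where x: "x = (i, a)" "i \<in> I" "a \<in> {0, 1}" by blast
    have "?f x = ((if a = 0 then \<pi> else \<rho>) i, g a)"
      using x by (simp add: wreath_perm_def)
    then show "?f x \<in> I \<times> {0, 1}"
      using x Z2_closed[OF g x(3)] perm by (simp add: permutes_in_image)
  qed
  ultimately show "bij_betw ?f (I \<times> {0, 1}) (I \<times> {0, 1})"
    using I by (simp add: bij_betw_def endo_inj_surj)
qed (auto simp: wreath_perm_def split: if_splits)

section \<open>Tracial states on the free wreath product by \<open>Z2\<close>\<close>

theorem proposition5p7:
  fixes I :: "'i set" and A :: "'a cstar" and U :: "'i \<Rightarrow> 'i \<Rightarrow> 'a"
    and C :: "'c cstar" and \<iota> :: "nat \<Rightarrow> 'a \<Rightarrow> 'c" and \<kappa> :: "((nat \<Rightarrow> nat) \<Rightarrow> complex) \<Rightarrow> 'c"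
  assumes "quantum_permutation_group I A U"
    and "cring A"
    and "free_wreath_product I A U {0, 1} (fun_cstar Z2) (perm_matrix Z2) C \<iota> \<kappa>"
  shows "\<not> nonlocal_symmetry (I \<times> {0, 1}) C (wreath_matrix U (perm_matrix Z2) C \<iota> \<kappa>)"
proof -
  have I: "finite I" and csA: "cstar_algebra A" and magic: "magic_unitary I A U"
    using assms(1) unfolding quantum_permutation_group_def compact_matrix_quantum_group_def
    by auto
  have csC: "cstar_algebra C"
    and rel: "wreath_relations I A U {0, 1} (fun_cstar Z2) (perm_matrix Z2) C \<iota> \<kappa>"
    using assms(3) unfolding free_wreath_product_def by auto
  interpret A: cstar_algebra A by (rule csA)
  interpret A: cring A by (rule assms(2))
  interpret C: cstar_algebra C by (rule csC)
  have U: "U i j \<in> carrier A" "adj A (U i j) = U i j" "U i j \<otimes>\<^bsub>A\<^esub> U i j = U i j"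
    if "i \<in> I" "j \<in> I" for i j
    using magic that unfolding magic_unitary_def by auto
  have hom: "\<iota> a \<in> star_hom A C" if "a \<in> {0, 1}" for a
    using rel that unfolding wreath_relations_def by blast
  have hom_ring: "ring_hom_ring A C (\<iota> a)" if "a \<in> {0, 1}" for a
    using hom[OF that] unfolding star_hom_def
    by (intro ring_hom_ringI2 A.ring_axioms C.ring_axioms) auto
  note \<iota>_simps = ring_hom_closed[OF ring_hom_ring.homh[OF hom_ring]]
    ring_hom_mult[OF ring_hom_ring.homh[OF hom_ring]]
    ring_hom_add[OF ring_hom_ring.homh[OF hom_ring]]
    ring_hom_one[OF ring_hom_ring.homh[OF hom_ring]]
  have \<iota>_uminus: "\<iota> a (\<ominus>\<^bsub>A\<^esub> x) = \<ominus>\<^bsub>C\<^esub> \<iota> a x" if "a \<in> {0, 1}" "x \<in> carrier A" for a x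
  proof -
    interpret h: ring_hom_ring A C "\<iota> a" using that(1) by (rule hom_ring)
    show ?thesis using that(2) by (rule h.hom_a_inv)
  qed
  have \<iota>_adj: "\<iota> a (adj A x) = adj C (\<iota> a x)" if "a \<in> {0, 1}" "x \<in> carrier A" for a x
    using hom[OF that(1)] that(2) unfolding star_hom_def by blast

  \<comment> \<open>Spectral projections of \<open>Z2\<close> and their commutation
    relations\<close>
  define e where "e g = \<kappa> (fun_delta Z2 g)" for g
  have \<kappa>: "\<kappa> \<in> ring_hom (fun_cstar Z2) C"
    and \<kappa>_adj: "\<And>x. x \<in> carrier (fun_cstar Z2) \<Longrightarrow> \<kappa> (adj (fun_cstar Z2) x) = adj C (\<kappa> x)"
    using rel unfolding wreath_relations_def star_hom_def by auto
  have e_closed [simp]: "e g \<in> carrier C" for g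
    unfolding e_def using \<kappa> fun_delta_facts(1) by (rule ring_hom_closed)
  have e_adj: "adj C (e g) = e g" for g
    unfolding e_def using \<kappa>_adj[OF fun_delta_facts(1)] by (simp add: fun_delta_facts(2))
  \<comment> \<open>A member of \<open>ring_hom\<close> is additive by definition; preservation of
    zero comes from \<open>0 + 0 = 0\<close>.\<close>
  have "\<kappa> \<zero>\<^bsub>fun_cstar Z2\<^esub> = \<zero>\<^bsub>C\<^esub>"
    using ring_hom_add[OF \<kappa> fun_cstar_zero(1) fun_cstar_zero(1)]
      ring_hom_closed[OF \<kappa> fun_cstar_zero(1)]
    by (simp add: fun_cstar_zero(2) C.add.r_cancel_one)
  then have e_mult: "e g \<otimes>\<^bsub>C\<^esub> e h = (if g = h then e g else \<zero>\<^bsub>C\<^esub>)" for g h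
    unfolding e_def
    using ring_hom_mult[OF \<kappa> fun_delta_facts(1)[of Z2 g] fun_delta_facts(1)[of Z2 h]]
    by (cases "g = h") (simp_all add: fun_delta_facts(3))
  have e_sum: "e id \<oplus>\<^bsub>C\<^esub> e (Transposition.transpose 0 1) = \<one>\<^bsub>C\<^esub>"
    unfolding e_def ring_hom_add[OF \<kappa> fun_delta_facts(1) fun_delta_facts(1), symmetric]
      fun_delta_Z2_sum by (rule ring_hom_one[OF \<kappa>])
  \<comment> \<open>The relations concern only row \<open>a\<close> of the matrix of
    \<open>Z2\<close> for copy \<open>a\<close>, but \<open>e g\<close> is its entry at column
    \<open>g a\<close>, so each copy commutes with every \<open>e g\<close>.\<close>
  have comm_U: "\<iota> a (U i j) \<otimes>\<^bsub>C\<^esub> e g = e g \<otimes>\<^bsub>C\<^esub> \<iota> a (U i j)"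
    if "a \<in> {0, 1}" "g \<in> Z2" "i \<in> I" "j \<in> I" for a g i j
    unfolding e_def perm_matrix_Z2[OF that(2,1), symmetric]
    using rel that Z2_closed[OF that(2,1)] unfolding wreath_relations_def by blast

  \<comment> \<open>What positivity of the weights will require of the \<open>p \<pi>\<close>, in a
    form inherited along ring operations. Products of self-adjoint elements stay self-adjoint
    because \<open>A\<close> is commutative.\<close>
  define M where "M = {x \<in> carrier A. adj A x = x \<and>
    (\<forall>a\<in>{0, 1}. \<forall>g\<in>Z2. \<iota> a x \<otimes>\<^bsub>C\<^esub> e g = e g \<otimes>\<^bsub>C\<^esub> \<iota> a x)}"
  have MI: "x \<in> M" if "x \<in> carrier A" "adj A x = x"
    "\<And>a g. a \<in> {0, 1} \<Longrightarrow> g \<in> Z2 \<Longrightarrow> \<iota> a x \<otimes>\<^bsub>C\<^esub> e g = e g \<otimes>\<^bsub>C\<^esub> \<iota> a x" for x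
    using that unfolding M_def by blast
  have MD: "x \<in> carrier A" "adj A x = x" if "x \<in> M" for x
    using that unfolding M_def by auto
  have M_comm: "\<iota> a x \<otimes>\<^bsub>C\<^esub> e g = e g \<otimes>\<^bsub>C\<^esub> \<iota> a x" if "x \<in> M" "a \<in> {0, 1}" "g \<in> Z2" for a g x
    using that unfolding M_def by blast
  have M: "subring M A"
  proof (rule A.subringI)
    show "M \<subseteq> carrier A" using MD by blast
    show "\<one>\<^bsub>A\<^esub> \<in> M"
      by (rule MI) (simp_all add: A.adj_one \<iota>_simps)
    show "\<ominus>\<^bsub>A\<^esub> x \<in> M" if x: "x \<in> M" for x
      by (rule MI) (use MD[OF x] M_comm[OF x] in
        \<open>simp_all add: A.adj_uminus \<iota>_uminus \<iota>_simps C.l_minus C.r_minus\<close>)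
    fix x y assume x: "x \<in> M" and y: "y \<in> M"
    note xy = MD[OF x] MD[OF y]
    show "x \<oplus>\<^bsub>A\<^esub> y \<in> M"
      by (rule MI) (use xy M_comm[OF x] M_comm[OF y] in
        \<open>simp_all add: A.adj_add \<iota>_simps C.l_distr C.r_distr\<close>)
    show "x \<otimes>\<^bsub>A\<^esub> y \<in> M"
    proof (rule MI)
      fix a g assume ag: "(a::nat) \<in> {0, 1}" "g \<in> Z2"
      have c: "\<iota> a x \<in> carrier C" "\<iota> a y \<in> carrier C"
        using xy ag \<iota>_simps(1) by auto
      have "\<iota> a x \<otimes>\<^bsub>C\<^esub> \<iota> a y \<otimes>\<^bsub>C\<^esub> e g = \<iota> a x \<otimes>\<^bsub>C\<^esub> e g \<otimes>\<^bsub>C\<^esub> \<iota> a y"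
        using c M_comm[OF y ag] by (simp add: C.m_assoc)
      also have "\<dots> = e g \<otimes>\<^bsub>C\<^esub> (\<iota> a x \<otimes>\<^bsub>C\<^esub> \<iota> a y)"
        using c M_comm[OF x ag] by (simp add: C.m_assoc)
      finally show "\<iota> a (x \<otimes>\<^bsub>A\<^esub> y) \<otimes>\<^bsub>C\<^esub> e g = e g \<otimes>\<^bsub>C\<^esub> \<iota> a (x \<otimes>\<^bsub>A\<^esub> y)"
        using \<iota>_simps(2) ag xy by simp
    qed (use xy in \<open>simp_all add: A.adj_mult A.m_comm\<close>)
  qed
  have UM: "U i j \<in> M" if "i \<in> I" "j \<in> I" for i j
    using U[OF that] comm_U that by (intro MI) auto

  obtain p where pM: "\<And>\<pi>. \<pi> permutes I \<Longrightarrow> p \<pi> \<in> M \<and> p \<pi> \<otimes>\<^bsub>A\<^esub> p \<pi> = p \<pi>"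
    and pU: "\<And>\<pi> i j. \<lbrakk>\<pi> permutes I; i \<in> I; j \<in> I\<rbrakk> \<Longrightarrow>
      p \<pi> \<otimes>\<^bsub>A\<^esub> U i j = (if \<pi> i = j then p \<pi> else \<zero>\<^bsub>A\<^esub>)"
    and p1: "(\<Oplus>\<^bsub>A\<^esub>\<pi>\<in>{\<pi>. \<pi> permutes I}. p \<pi>) = \<one>\<^bsub>A\<^esub>"
    using A.commutative_magic_decomposition[OF A.torsion_free M I, of U] UM U(3) magic
    unfolding magic_unitary_def by blast
  let ?P = "{\<pi>. \<pi> permutes I}"
  have P: "finite ?P" using I by (rule finite_permutations)
  have pc: "p \<pi> \<in> carrier A" if "\<pi> permutes I" for \<pi>
    using pM[OF that] MD by blast

  show ?thesis
    unfolding nonlocal_symmetry_def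
  proof (intro notI, elim exE conjE)
    fix \<tau> assume \<tau>: "tracial_state C \<tau>"
      and nonlocal: "\<not> local_correlation (I \<times> {0, 1})
        (trace_correlation C (wreath_matrix U (perm_matrix Z2) C \<iota> \<kappa>) \<tau>)"
    have \<tau>_add: "\<tau> (x \<oplus>\<^bsub>C\<^esub> y) = \<tau> x + \<tau> y"
      and \<tau>_comm: "\<tau> (x \<otimes>\<^bsub>C\<^esub> y) = \<tau> (y \<otimes>\<^bsub>C\<^esub> x)"
      if "x \<in> carrier C" "y \<in> carrier C" for x y
      using \<tau> that unfolding tracial_state_def by blast+
    have \<tau>_one: "\<tau> \<one>\<^bsub>C\<^esub> = 1"
      using \<tau> unfolding tracial_state_def by blast
    have \<tau>_zero: "\<tau> \<zero>\<^bsub>C\<^esub> = 0"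
      using \<tau>_add[of "\<zero>\<^bsub>C\<^esub>" "\<zero>\<^bsub>C\<^esub>"] by simp

    \<comment> \<open>Traces with one factor from each copy\<close>
    define B where "B g x y = \<tau> (\<iota> 0 x \<otimes>\<^bsub>C\<^esub> \<iota> 1 y \<otimes>\<^bsub>C\<^esub> e g)" for g x y
    have B_add_left: "B g (x \<oplus>\<^bsub>A\<^esub> x') y = B g x y + B g x' y"
      if "x \<in> carrier A" "x' \<in> carrier A" "y \<in> carrier A" for g x x' y
      unfolding B_def using that by (simp add: \<iota>_simps C.l_distr \<tau>_add)
    have B_add_right: "B g x (y \<oplus>\<^bsub>A\<^esub> y') = B g x y + B g x y'"
      if "x \<in> carrier A" "y \<in> carrier A" "y' \<in> carrier A" for g x y y'
      unfolding B_def using that by (simp add: \<iota>_simps C.l_distr C.r_distr \<tau>_add)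
    have B_zero: "B g \<zero>\<^bsub>A\<^esub> x = 0" "B g x \<zero>\<^bsub>A\<^esub> = 0" if "x \<in> carrier A" for g x
      using B_add_left[of "\<zero>\<^bsub>A\<^esub>" "\<zero>\<^bsub>A\<^esub>" x g] B_add_right[of x "\<zero>\<^bsub>A\<^esub>" "\<zero>\<^bsub>A\<^esub>" g] that by simp_all
    have expand: "x = (\<Oplus>\<^bsub>A\<^esub>\<pi>\<in>?P. p \<pi> \<otimes>\<^bsub>A\<^esub> x)" if "x \<in> carrier A" for x
      using A.finsum_ldistr[OF P that, of p] pc p1 that by (simp add: Pi_def)
    \<comment> \<open>The predicates \<open>\<phi>\<close> and \<open>\<psi>\<close> record on which
      pieces \<open>x\<close> and \<open>y\<close> act as \<open>1\<close>. Inserting the sum of all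
      pieces in both slots and using additivity leaves the pairs of pieces that satisfy
      both.\<close>
    have B_expand: "B g x y = (\<Sum>\<pi>\<in>?P. \<Sum>\<rho>\<in>?P. if \<phi> \<pi> \<and> \<psi> \<rho> then B g (p \<pi>) (p \<rho>) else 0)"
      if x: "x \<in> carrier A" "\<And>\<pi>. \<pi> permutes I \<Longrightarrow> p \<pi> \<otimes>\<^bsub>A\<^esub> x = (if \<phi> \<pi> then p \<pi> else \<zero>\<^bsub>A\<^esub>)"
        and y: "y \<in> carrier A" "\<And>\<pi>. \<pi> permutes I \<Longrightarrow> p \<pi> \<otimes>\<^bsub>A\<^esub> y = (if \<psi> \<pi> then p \<pi> else \<zero>\<^bsub>A\<^esub>)"
      for g x y \<phi> \<psi>
    proof -
      have "B g x y = B g (\<Oplus>\<^bsub>A\<^esub>\<pi>\<in>?P. p \<pi> \<otimes>\<^bsub>A\<^esub> x) y"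
        using expand[OF x(1)] by simp
      also have "\<dots> = (\<Sum>\<pi>\<in>?P. B g (p \<pi> \<otimes>\<^bsub>A\<^esub> x) y)"
        using B_add_left B_zero(1) pc x(1) y(1)
        by (intro A.additive_finsum[OF P, where f = "\<lambda>x. B g x y"]) auto
      also have "\<dots> = (\<Sum>\<pi>\<in>?P. \<Sum>\<rho>\<in>?P. B g (p \<pi> \<otimes>\<^bsub>A\<^esub> x) (p \<rho> \<otimes>\<^bsub>A\<^esub> y))"
      proof (intro sum.cong refl)
        fix \<pi> assume "\<pi> \<in> ?P"
        then have c: "p \<pi> \<otimes>\<^bsub>A\<^esub> x \<in> carrier A" using pc x by simp
        have "B g (p \<pi> \<otimes>\<^bsub>A\<^esub> x) y = B g (p \<pi> \<otimes>\<^bsub>A\<^esub> x) (\<Oplus>\<^bsub>A\<^esub>\<rho>\<in>?P. p \<rho> \<otimes>\<^bsub>A\<^esub> y)"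
          using expand[OF y(1)] by simp
        also have "\<dots> = (\<Sum>\<rho>\<in>?P. B g (p \<pi> \<otimes>\<^bsub>A\<^esub> x) (p \<rho> \<otimes>\<^bsub>A\<^esub> y))"
          using B_add_right[OF c] B_zero(2)[OF c] pc y(1)
          by (intro A.additive_finsum[OF P]) auto
        finally show "B g (p \<pi> \<otimes>\<^bsub>A\<^esub> x) y = (\<Sum>\<rho>\<in>?P. B g (p \<pi> \<otimes>\<^bsub>A\<^esub> x) (p \<rho> \<otimes>\<^bsub>A\<^esub> y))" .
      qed
      also have "\<dots> = (\<Sum>\<pi>\<in>?P. \<Sum>\<rho>\<in>?P. if \<phi> \<pi> \<and> \<psi> \<rho> then B g (p \<pi>) (p \<rho>) else 0)"
        using x(2) y(2) pc B_zero by (intro sum.cong refl) auto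
      finally show ?thesis .
    qed

    have B_nonneg: "B g (p \<pi>) (p \<rho>) \<in> \<real>\<^sub>\<ge>\<^sub>0" if "\<pi> permutes I" "\<rho> permutes I" "g \<in> Z2" for g \<pi> \<rho>
    proof -
      have \<iota>p: "\<iota> a (p \<sigma>) \<in> carrier C \<and> adj C (\<iota> a (p \<sigma>)) = \<iota> a (p \<sigma>) \<and>
        \<iota> a (p \<sigma>) \<otimes>\<^bsub>C\<^esub> \<iota> a (p \<sigma>) = \<iota> a (p \<sigma>)" if "a \<in> {0, 1}" "\<sigma> permutes I" for a \<sigma>
        using pM[OF that(2)] MD[of "p \<sigma>"] \<iota>_simps(1,2)[OF that(1)] \<iota>_adj[OF that(1), of "p \<sigma>"]
        by metis
      let ?x = "\<iota> 0 (p \<pi>)" and ?y = "\<iota> 1 (p \<rho>)"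
      have x: "?x \<in> carrier C" "adj C ?x = ?x" "?x \<otimes>\<^bsub>C\<^esub> ?x = ?x"
        and y: "?y \<in> carrier C" "adj C ?y = ?y" "?y \<otimes>\<^bsub>C\<^esub> ?y = ?y"
        using \<iota>p[of 0 \<pi>] \<iota>p[of 1 \<rho>] that by auto
      have ye: "?y \<otimes>\<^bsub>C\<^esub> e g = e g \<otimes>\<^bsub>C\<^esub> ?y"
        using M_comm[of "p \<rho>" 1 g] pM that by simp
      \<comment> \<open>As \<open>?y\<close> and \<open>e g\<close> commute, their product is again
        a projection; the weight is then the trace of a product of two projections.\<close>
      have "?y \<otimes>\<^bsub>C\<^esub> e g \<otimes>\<^bsub>C\<^esub> (?y \<otimes>\<^bsub>C\<^esub> e g) = ?y \<otimes>\<^bsub>C\<^esub> (e g \<otimes>\<^bsub>C\<^esub> ?y) \<otimes>\<^bsub>C\<^esub> e g"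
        using y by (simp add: C.m_assoc)
      also have "\<dots> = (?y \<otimes>\<^bsub>C\<^esub> ?y) \<otimes>\<^bsub>C\<^esub> (e g \<otimes>\<^bsub>C\<^esub> e g)"
        unfolding ye[symmetric] using y(1) by (simp add: C.m_assoc)
      also have "\<dots> = ?y \<otimes>\<^bsub>C\<^esub> e g"
        using y e_mult by simp
      finally have "\<tau> (?x \<otimes>\<^bsub>C\<^esub> (?y \<otimes>\<^bsub>C\<^esub> e g)) \<in> \<real>\<^sub>\<ge>\<^sub>0"
        using x y ye e_adj by (intro C.trace_projections_nonneg[OF \<tau>]) (auto simp: C.adj_mult)
      then show ?thesis
        unfolding B_def using x y by (simp add: C.m_assoc)
    qed

    \<comment> \<open>Traces of products of two entries of the fundamental representation\<close>
    define W where "W = wreath_matrix U (perm_matrix Z2) C \<iota> \<kappa>"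
    define sel where "sel a \<pi> \<rho> = (if a = 0 then \<pi> else \<rho>)" for a :: nat and \<pi> \<rho> :: "'i \<Rightarrow> 'i"
    have W: "W (i, a) (l, g a) = \<iota> a (U i l) \<otimes>\<^bsub>C\<^esub> e g" if "a \<in> {0, 1}" "g \<in> Z2" for i a l g
      unfolding W_def wreath_matrix_def e_def using perm_matrix_Z2[OF that(2,1)] by simp
    \<comment> \<open>\<open>e g\<close> commutes with both copies, so it can be moved past the
      second factor to meet \<open>e h\<close>.\<close>
    have WW: "W (i, a) (l, g a) \<otimes>\<^bsub>C\<^esub> W (j, b) (k, h b)
        = \<iota> a (U i l) \<otimes>\<^bsub>C\<^esub> \<iota> b (U j k) \<otimes>\<^bsub>C\<^esub> (e g \<otimes>\<^bsub>C\<^esub> e h)"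
      if "a \<in> {0, 1}" "b \<in> {0, 1}" "g \<in> Z2" "h \<in> Z2" "i \<in> I" "j \<in> I" "k \<in> I" "l \<in> I" for a b g h i j k l
    proof -
      have c: "\<iota> a (U i l) \<in> carrier C" "\<iota> b (U j k) \<in> carrier C"
        using U(1) \<iota>_simps(1) that by auto
      have "W (i, a) (l, g a) \<otimes>\<^bsub>C\<^esub> W (j, b) (k, h b)
        = \<iota> a (U i l) \<otimes>\<^bsub>C\<^esub> (e g \<otimes>\<^bsub>C\<^esub> \<iota> b (U j k)) \<otimes>\<^bsub>C\<^esub> e h"
        using W that c by (simp add: C.m_assoc)
      also have "\<dots> = \<iota> a (U i l) \<otimes>\<^bsub>C\<^esub> \<iota> b (U j k) \<otimes>\<^bsub>C\<^esub> (e g \<otimes>\<^bsub>C\<^esub> e h)"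
        using comm_U[OF that(2,3,6,7), symmetric] c by (simp add: C.m_assoc)
      finally show ?thesis .
    qed
    have corr: "\<tau> (\<iota> a (U i l) \<otimes>\<^bsub>C\<^esub> \<iota> b (U j k) \<otimes>\<^bsub>C\<^esub> e g)
        = (\<Sum>\<pi>\<in>?P. \<Sum>\<rho>\<in>?P. if sel a \<pi> \<rho> i = l \<and> sel b \<pi> \<rho> j = k then B g (p \<pi>) (p \<rho>) else 0)"
      if ab: "a \<in> {0, 1}" "b \<in> {0, 1}" and g: "g \<in> Z2"
        and ijkl: "i \<in> I" "j \<in> I" "k \<in> I" "l \<in> I" for a b g i j k l
    proof -
      let ?x = "U i l" and ?y = "U j k"
      have x: "?x \<in> carrier A" "\<And>\<pi>. \<pi> permutes I \<Longrightarrow> p \<pi> \<otimes>\<^bsub>A\<^esub> ?x = (if \<pi> i = l then p \<pi> else \<zero>\<^bsub>A\<^esub>)"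
        using U pU ijkl by auto
      have y: "?y \<in> carrier A" "\<And>\<pi>. \<pi> permutes I \<Longrightarrow> p \<pi> \<otimes>\<^bsub>A\<^esub> ?y = (if \<pi> j = k then p \<pi> else \<zero>\<^bsub>A\<^esub>)"
        using U pU ijkl by auto
      have xy: "?x \<otimes>\<^bsub>A\<^esub> ?y \<in> carrier A" "\<And>\<pi>. \<pi> permutes I \<Longrightarrow>
          p \<pi> \<otimes>\<^bsub>A\<^esub> (?x \<otimes>\<^bsub>A\<^esub> ?y) = (if \<pi> i = l \<and> \<pi> j = k then p \<pi> else \<zero>\<^bsub>A\<^esub>)"
        using x y pc by (auto simp: A.m_assoc[symmetric])
      \<comment> \<open>The unit acts as \<open>1\<close> on all pieces; the test
        \<open>True\<close> gives it the shape that \<open>B_expand\<close> expects.\<close>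
      have one: "\<one>\<^bsub>A\<^esub> \<in> carrier A" "\<And>\<pi>. \<pi> permutes I \<Longrightarrow>
          p \<pi> \<otimes>\<^bsub>A\<^esub> \<one>\<^bsub>A\<^esub> = (if True then p \<pi> else \<zero>\<^bsub>A\<^esub>)"
        using pc by auto
      consider "a = 0" "b = 0" | "a = 0" "b = 1" | "a = 1" "b = 0" | "a = 1" "b = 1"
        using ab by blast
      then show ?thesis
      proof cases
        \<comment> \<open>Both factors come from copy 0: they are multiplied inside
          \<open>A\<close>, and copy 1 contributes the unit.\<close>
        case 1
        then have "\<tau> (\<iota> a ?x \<otimes>\<^bsub>C\<^esub> \<iota> b ?y \<otimes>\<^bsub>C\<^esub> e g) = B g (?x \<otimes>\<^bsub>A\<^esub> ?y) \<one>\<^bsub>A\<^esub>"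
          unfolding B_def using x y by (simp add: \<iota>_simps)
        also have "\<dots> = (\<Sum>\<pi>\<in>?P. \<Sum>\<rho>\<in>?P. if (\<pi> i = l \<and> \<pi> j = k) \<and> True then B g (p \<pi>) (p \<rho>) else 0)"
          by (rule B_expand) (fact xy one)+
        finally show ?thesis unfolding sel_def 1 by simp
      next
        case 2
        then have "\<tau> (\<iota> a ?x \<otimes>\<^bsub>C\<^esub> \<iota> b ?y \<otimes>\<^bsub>C\<^esub> e g) = B g ?x ?y"
          unfolding B_def by simp
        also have "\<dots> = (\<Sum>\<pi>\<in>?P. \<Sum>\<rho>\<in>?P. if \<pi> i = l \<and> \<rho> j = k then B g (p \<pi>) (p \<rho>) else 0)"
          by (rule B_expand) (fact x y)+
        finally show ?thesis unfolding sel_def 2 by simp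
      next
        \<comment> \<open>The copies stand in the opposite order to that in \<open>B\<close>. The
          trace property takes the factor of copy 1 to the end, and it then commutes past
          \<open>e g\<close>.\<close>
        case 3
        have c: "\<iota> 1 ?x \<in> carrier C" "\<iota> 0 ?y \<in> carrier C"
          using x(1) y(1) by (auto intro!: \<iota>_simps(1))
        have "\<tau> (\<iota> 1 ?x \<otimes>\<^bsub>C\<^esub> \<iota> 0 ?y \<otimes>\<^bsub>C\<^esub> e g) = \<tau> (\<iota> 1 ?x \<otimes>\<^bsub>C\<^esub> (\<iota> 0 ?y \<otimes>\<^bsub>C\<^esub> e g))"
          using c by (simp add: C.m_assoc)
        also have "\<dots> = \<tau> (\<iota> 0 ?y \<otimes>\<^bsub>C\<^esub> e g \<otimes>\<^bsub>C\<^esub> \<iota> 1 ?x)"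
          using c by (intro \<tau>_comm) auto
        also have "\<dots> = \<tau> (\<iota> 0 ?y \<otimes>\<^bsub>C\<^esub> (e g \<otimes>\<^bsub>C\<^esub> \<iota> 1 ?x))"
          using c by (simp add: C.m_assoc)
        also have "e g \<otimes>\<^bsub>C\<^esub> \<iota> 1 ?x = \<iota> 1 ?x \<otimes>\<^bsub>C\<^esub> e g"
          using comm_U[of 1 g i l] g ijkl by simp
        also have "\<tau> (\<iota> 0 ?y \<otimes>\<^bsub>C\<^esub> (\<iota> 1 ?x \<otimes>\<^bsub>C\<^esub> e g)) = B g ?y ?x"
          unfolding B_def using c by (simp add: C.m_assoc)
        also have "\<dots> = (\<Sum>\<pi>\<in>?P. \<Sum>\<rho>\<in>?P. if \<pi> j = k \<and> \<rho> i = l then B g (p \<pi>) (p \<rho>) else 0)"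
          by (rule B_expand) (fact x y)+
        finally show ?thesis unfolding sel_def 3 by (simp add: conj_commute)
      next
        case 4
        then have "\<tau> (\<iota> a ?x \<otimes>\<^bsub>C\<^esub> \<iota> b ?y \<otimes>\<^bsub>C\<^esub> e g) = B g \<one>\<^bsub>A\<^esub> (?x \<otimes>\<^bsub>A\<^esub> ?y)"
          unfolding B_def using x y by (simp add: \<iota>_simps)
        also have "\<dots> = (\<Sum>\<pi>\<in>?P. \<Sum>\<rho>\<in>?P. if True \<and> (\<rho> i = l \<and> \<rho> j = k) then B g (p \<pi>) (p \<rho>) else 0)"
          by (rule B_expand) (fact xy one)+
        finally show ?thesis unfolding sel_def 4 by simp
      qed
    qed

    \<comment> \<open>The convex combination\<close>
    define T where "T = ?P \<times> ?P \<times> Z2"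
    \<comment> \<open>The coefficients must be real; \<open>wB\<close> shows that taking real parts
      loses nothing, since the values are non-negative.\<close>
    define w where "w = (\<lambda>(\<pi>, \<rho>, g). Re (B g (p \<pi>) (p \<rho>)))"
    have T_sum: "(\<Sum>t\<in>T. f t) = (\<Sum>\<pi>\<in>?P. \<Sum>\<rho>\<in>?P. \<Sum>g\<in>Z2. f (\<pi>, \<rho>, g))" for f :: "_ \<Rightarrow> 'z::comm_monoid_add"
      unfolding T_def by (simp add: sum.cartesian_product split_def)
    have wB: "complex_of_real (w (\<pi>, \<rho>, g)) = B g (p \<pi>) (p \<rho>)"
      if "\<pi> permutes I" "\<rho> permutes I" "g \<in> Z2" for \<pi> \<rho> g
      using B_nonneg[OF that] unfolding w_def
      by (auto simp: complex_nonneg_Reals_iff complex_eq_iff)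
    have "local_correlation (I \<times> {0, 1}) (trace_correlation C W \<tau>)"
    proof (rule local_correlationI[of _ T "wreath_perm I" w])
      show "finite T" unfolding T_def using P finite_Z2 by simp
      show "wreath_perm I t permutes (I \<times> {0, 1})" if "t \<in> T" for t
        using that I wreath_perm_permutes unfolding T_def by blast
      show "0 \<le> w t" if "t \<in> T" for t
        using that B_nonneg unfolding T_def w_def by (auto simp: complex_nonneg_Reals_iff)
      \<comment> \<open>Total weight: for each \<open>g\<close> the pieces of both copies add up to
        the unit, leaving \<open>\<tau> (e g)\<close>, and the two \<open>e g\<close> add up to the
        unit as well.\<close>
      have "complex_of_real (sum w T) = (\<Sum>\<pi>\<in>?P. \<Sum>\<rho>\<in>?P. \<Sum>g\<in>Z2. B g (p \<pi>) (p \<rho>))"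
        unfolding of_real_sum T_sum using wB by (intro sum.cong refl) auto
      also have "\<dots> = (\<Sum>g\<in>Z2. \<Sum>\<pi>\<in>?P. \<Sum>\<rho>\<in>?P. B g (p \<pi>) (p \<rho>))"
        by (simp only: sum.swap[of _ Z2])
      also have "\<dots> = (\<Sum>g\<in>Z2. \<tau> (e g))"
      proof (intro sum.cong refl)
        fix g
        have "B g \<one>\<^bsub>A\<^esub> \<one>\<^bsub>A\<^esub> = (\<Sum>\<pi>\<in>?P. \<Sum>\<rho>\<in>?P. if True \<and> True then B g (p \<pi>) (p \<rho>) else 0)"
          using pc by (intro B_expand) auto
        moreover have "B g \<one>\<^bsub>A\<^esub> \<one>\<^bsub>A\<^esub> = \<tau> (e g)"
          unfolding B_def by (simp add: \<iota>_simps)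
        ultimately show "(\<Sum>\<pi>\<in>?P. \<Sum>\<rho>\<in>?P. B g (p \<pi>) (p \<rho>)) = \<tau> (e g)" by simp
      qed
      also have "\<dots> = \<tau> (e id \<oplus>\<^bsub>C\<^esub> e (Transposition.transpose 0 1))"
      proof -
        have "id \<noteq> Transposition.transpose 0 (1::nat)"
          by (auto simp: fun_eq_iff Transposition.transpose_def)
        then show ?thesis by (simp add: Z2_eq \<tau>_add)
      qed
      also have "\<dots> = 1"
        using e_sum \<tau>_one by simp
      finally show "sum w T = 1" by (simp only: of_real_eq_1_iff)
      fix l' k' i' j' :: "'i \<times> nat" assume mem: "l' \<in> I \<times> {0, 1}" "k' \<in> I \<times> {0, 1}"
        "i' \<in> I \<times> {0, 1}" "j' \<in> I \<times> {0, 1}"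
      obtain i a j b where ij: "i' = (i, a)" "j' = (j, b)" "i \<in> I" "j \<in> I" "a \<in> {0, 1}" "b \<in> {0, 1}"
        using mem(3,4) by blast
      obtain l a' k b' where lk: "l' = (l, a')" "k' = (k, b')" "l \<in> I" "k \<in> I" "a' \<in> {0, 1}" "b' \<in> {0, 1}"
        using mem(1,2) by blast
      \<comment> \<open>The target blocks are rewritten as \<open>g a\<close> and
        \<open>h b\<close>, so that the entries become products with \<open>e g\<close> and
        \<open>e h\<close>; orthogonality then kills the case \<open>g \<noteq> h\<close>.\<close>
      obtain g where g: "g \<in> Z2" "g a = a'" using ij(5) lk(5) by (rule Z2_transitive)
      obtain h where h: "h \<in> Z2" "h b = b'" using ij(6) lk(6) by (rule Z2_transitive)
      have "trace_correlation C W \<tau> l' k' i' j'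
        = \<tau> (\<iota> a (U i l) \<otimes>\<^bsub>C\<^esub> \<iota> b (U j k) \<otimes>\<^bsub>C\<^esub> (e g \<otimes>\<^bsub>C\<^esub> e h))"
        unfolding trace_correlation_def ij(1,2) lk(1,2)
        using WW[of a b g h i j k l] ij lk g h by simp
      also have "\<dots> = (if g = h then \<tau> (\<iota> a (U i l) \<otimes>\<^bsub>C\<^esub> \<iota> b (U j k) \<otimes>\<^bsub>C\<^esub> e g) else 0)"
        using ij lk U(1) \<iota>_simps(1) e_mult \<tau>_zero by simp
      also have "\<dots> = (\<Sum>\<pi>\<in>?P. \<Sum>\<rho>\<in>?P. if g = h \<and> sel a \<pi> \<rho> i = l \<and> sel b \<pi> \<rho> j = k
          then B g (p \<pi>) (p \<rho>) else 0)"
        using corr[OF ij(5,6) g(1) ij(3,4) lk(4,3)] by (cases "g = h") simp_all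
      also have "\<dots> = (\<Sum>\<pi>\<in>?P. \<Sum>\<rho>\<in>?P. \<Sum>f\<in>Z2. of_real (w (\<pi>, \<rho>, f) *
          perm_correlation (wreath_perm I (\<pi>, \<rho>, f)) l' k' i' j'))"
      proof (intro sum.cong refl)
        fix \<pi> \<rho> assume perm: "\<pi> \<in> ?P" "\<rho> \<in> ?P"
        let ?c = "g = h \<and> sel a \<pi> \<rho> i = l \<and> sel b \<pi> \<rho> j = k"
        have "complex_of_real (w (\<pi>, \<rho>, f) *
            perm_correlation (wreath_perm I (\<pi>, \<rho>, f)) l' k' i' j')
          = (if f = g then if ?c then B g (p \<pi>) (p \<rho>) else 0 else 0)" if f: "f \<in> Z2" for f
        proof -
          have "wreath_perm I (\<pi>, \<rho>, f) i' = (sel a \<pi> \<rho> i, f a)"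
            "wreath_perm I (\<pi>, \<rho>, f) j' = (sel b \<pi> \<rho> j, f b)"
            using ij by (simp_all add: wreath_perm_def sel_def)
          \<comment> \<open>By freeness of the action, the permutation of
            \<open>(\<pi>, \<rho>, f)\<close> sends both blocks to the right places only if
            \<open>f = g\<close> and \<open>f = h\<close>. The sum over \<open>f\<close> thus
            reduces to the term at \<open>g\<close>, which is present only for
            \<open>g = h\<close>.\<close>
          moreover have "a' = f a \<longleftrightarrow> f = g" "b' = f b \<longleftrightarrow> f = h"
            using Z2_regular(1)[OF f g(1) ij(5)] Z2_regular(1)[OF f h(1) ij(6)] g h by auto
          ultimately show ?thesis
            unfolding perm_correlation_def lk(1,2) using wB[of \<pi> \<rho> f] perm f by auto
        qed
        then have "(\<Sum>f\<in>Z2. complex_of_real (w (\<pi>, \<rho>, f) *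
            perm_correlation (wreath_perm I (\<pi>, \<rho>, f)) l' k' i' j'))
          = (\<Sum>f\<in>Z2. if f = g then if ?c then B g (p \<pi>) (p \<rho>) else 0 else 0)"
          by (intro sum.cong refl) auto
        also have "\<dots> = (if ?c then B g (p \<pi>) (p \<rho>) else 0)"
          using g(1) finite_Z2 by (simp add: sum.delta)
        finally show "(if ?c then B g (p \<pi>) (p \<rho>) else 0) = (\<Sum>f\<in>Z2. complex_of_real (w (\<pi>, \<rho>, f) *
            perm_correlation (wreath_perm I (\<pi>, \<rho>, f)) l' k' i' j'))" by simp
      qed
      finally show "trace_correlation C W \<tau> l' k' i' j' = of_real
          (\<Sum>t\<in>T. w t * perm_correlation (wreath_perm I t) l' k' i' j')"
        unfolding T_sum of_real_sum .
    qed (use I in simp)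
    then show False using nonlocal unfolding W_def by blast
  qed
qed

end
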